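(* Let $\kappa$ be a weak metric on a set $X$ and let $(Y,\sigma)$ be a pseudometric space. Then a map $f:X\to Y$ is lower Lipschitz if and only if the function $\kappa:(X\times X,\ f^{\ast}\sigma\oplus f^{\ast}\sigma)\to[0,\infty)$ is Lipschitz. In this case, we have $\operatorname{Lip}(\kappa)=\operatorname{Lip}(f^{-1}:f(X)\to X)$. If, in addition, $f$ is Lipschitz, then $f:(X,\kappa)\to(f(X),\sigma)$ is a bi-Lipschitz equivalence.
   Context: A weak metric on $X$ is a function $\kappa:X\times X\to\mathbb{R}$ with $\kappa(x,z)\le\kappa(x,y)+\kappa(y,z)$, $\kappa(x,y)\ge 0$ and $\kappa(x,x)=0$ for all $x,y,z\in X$ (symmetry is not assumed). A pseudometric is a symmetric weak metric. For $f:X\to Y$, $f^{\ast}\sigma$ is the pseudometric on $X$ given by $f^{\ast}\sigma(x,x')=\sigma(f(x),f(x'))$. A map $f:X\to Y$ is Lipschitz (in $\kappa$ and $\sigma$) if there is $L\ge 0$ with $\sigma(f(x),f(x'))\le L\,[\kappa(x,x')\vee\kappa(x',x)]$ for all $x,x'\in X$, where $\vee$ denotes maximum; $\operatorname{Lip}(f)$ is the smallest such $L$. It is lower Lipschitz if there is $\ell>0$ with $\ell\,[\kappa(x,x')\vee\kappa(x',x)]\le\sigma(f(x),f(x'))$ for all $x,x'\in X$ (since $\sigma$ is symmetric, this is the same as $\ell\,\kappa(x,x')\le\sigma(f(x),f(x'))$ for all $x,x'$). It is a bi-Lipschitz equivalence onto its image if it is both Lipschitz and lower Lipschitz. $\operatorname{Lip}(f^{-1}:f(X)\to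 X)$ is the smallest $L\ge 0$ with $\kappa(x,x')\le L\,\sigma(f(x),f(x'))$ for all $x,x'\in X$. For pseudometric spaces $(A,\alpha)$ and $(B,\beta)$, $\alpha\oplus\beta$ denotes any one of the bi-Lipschitz equivalent pseudometrics $\alpha\vee\beta$ or $(\alpha^p+\beta^p)^{1/p}$, $1\le p<\infty$, on $A\times B$ (with $\alpha$ applied to the first coordinates and $\beta$ to the second). The interval $[0,\infty)$ carries the usual metric $|s-t|$, and $\operatorname{Lip}(\kappa)$ is the smallest Lipschitz constant of $\kappa$ on $X\times X$ with respect to $f^{\ast}\sigma\oplus f^{\ast}\sigma$.
   Formalization: The equality Lip(κ) = Lip(f⁻¹) is stated only for ⊕ taken as the sum (p = 1); for the maximum and every p > 1 it is false, e.g. for the identity of the real line with the usual metric. The equivalence is stated for every choice of ⊕. *)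

theory Defs
  imports "HOL-Analysis.Analysis"
begin

definition weak_metric_on :: "'a set \<Rightarrow> ('a \<Rightarrow> 'a \<Rightarrow> real) \<Rightarrow> bool" where
  "weak_metric_on X \<kappa> \<longleftrightarrow>
     (\<forall>x\<in>X. \<forall>y\<in>X. \<forall>z\<in>X. \<kappa> x z \<le> \<kappa> x y + \<kappa> y z) \<and>
     (\<forall>x\<in>X. \<forall>y\<in>X. 0 \<le> \<kappa> x y) \<and>
     (\<forall>x\<in>X. \<kappa> x x = 0)"

definition pseudometric_on :: "'a set \<Rightarrow> ('a \<Rightarrow> 'a \<Rightarrow> real) \<Rightarrow> bool" where
  "pseudometric_on Y \<sigma> \<longleftrightarrow>
     weak_metric_on Y \<sigma> \<and> (\<forall>x\<in>Y. \<forall>y\<in>Y. \<sigma> x y = \<sigma> y x)"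

definition pullback :: "('a \<Rightarrow> 'b) \<Rightarrow> ('b \<Rightarrow> 'b \<Rightarrow> real) \<Rightarrow> 'a \<Rightarrow> 'a \<Rightarrow> real" where
  "pullback f \<sigma> x x' = \<sigma> (f x) (f x')"

definition lipschitz_const ::
  "'a set \<Rightarrow> ('a \<Rightarrow> 'a \<Rightarrow> real) \<Rightarrow> ('b \<Rightarrow> 'b \<Rightarrow> real) \<Rightarrow> ('a \<Rightarrow> 'b) \<Rightarrow> real \<Rightarrow> bool" where
  "lipschitz_const X \<kappa> \<sigma> f L \<longleftrightarrow>
     0 \<le> L \<and> (\<forall>x\<in>X. \<forall>x'\<in>X. \<sigma> (f x) (f x') \<le> L * max (\<kappa> x x') (\<kappa> x' x))"

definition lipschitz_map ::
  "'a set \<Rightarrow> ('a \<Rightarrow> 'a \<Rightarrow> real) \<Rightarrow> ('b \<Rightarrow> 'b \<Rightarrow> real) \<Rightarrow> ('a \<Rightarrow> 'b) \<Rightarrow> bool" where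
  "lipschitz_map X \<kappa> \<sigma> f \<longleftrightarrow> (\<exists>L. lipschitz_const X \<kappa> \<sigma> f L)"

definition Lip ::
  "'a set \<Rightarrow> ('a \<Rightarrow> 'a \<Rightarrow> real) \<Rightarrow> ('b \<Rightarrow> 'b \<Rightarrow> real) \<Rightarrow> ('a \<Rightarrow> 'b) \<Rightarrow> real" where
  "Lip X \<kappa> \<sigma> f = (LEAST L. lipschitz_const X \<kappa> \<sigma> f L)"

definition lower_lipschitz_map ::
  "'a set \<Rightarrow> ('a \<Rightarrow> 'a \<Rightarrow> real) \<Rightarrow> ('b \<Rightarrow> 'b \<Rightarrow> real) \<Rightarrow> ('a \<Rightarrow> 'b) \<Rightarrow> bool" where
  "lower_lipschitz_map X \<kappa> \<sigma> f \<longleftrightarrow>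
     (\<exists>l>0. \<forall>x\<in>X. \<forall>x'\<in>X. l * max (\<kappa> x x') (\<kappa> x' x) \<le> \<sigma> (f x) (f x'))"

definition bi_lipschitz_onto_image ::
  "'a set \<Rightarrow> ('a \<Rightarrow> 'a \<Rightarrow> real) \<Rightarrow> ('b \<Rightarrow> 'b \<Rightarrow> real) \<Rightarrow> ('a \<Rightarrow> 'b) \<Rightarrow> bool" where
  "bi_lipschitz_onto_image X \<kappa> \<sigma> f \<longleftrightarrow>
     lipschitz_map X \<kappa> \<sigma> f \<and> lower_lipschitz_map X \<kappa> \<sigma> f"

text \<open>Since \<open>\<sigma>\<close> is only a pseudometric, \<open>f\<close> need not be injective, so the Lipschitz constant
  of \<open>f\<^sup>-\<^sup>1 : f(X) \<rightarrow> X\<close> is expressed through \<open>f\<close> rather than through an inverse function.\<close>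

definition Lip_inverse ::
  "'a set \<Rightarrow> ('a \<Rightarrow> 'a \<Rightarrow> real) \<Rightarrow> ('b \<Rightarrow> 'b \<Rightarrow> real) \<Rightarrow> ('a \<Rightarrow> 'b) \<Rightarrow> real" where
  "Lip_inverse X \<kappa> \<sigma> f =
     (LEAST L. 0 \<le> L \<and> (\<forall>x\<in>X. \<forall>x'\<in>X. \<kappa> x x' \<le> L * \<sigma> (f x) (f x')))"

definition oplus_max ::
  "('a \<Rightarrow> 'a \<Rightarrow> real) \<Rightarrow> ('b \<Rightarrow> 'b \<Rightarrow> real) \<Rightarrow> 'a \<times> 'b \<Rightarrow> 'a \<times> 'b \<Rightarrow> real" where
  "oplus_max \<alpha> \<beta> u v = max (\<alpha> (fst u) (fst v)) (\<beta> (snd u) (snd v))"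

definition oplus_p ::
  "real \<Rightarrow> ('a \<Rightarrow> 'a \<Rightarrow> real) \<Rightarrow> ('b \<Rightarrow> 'b \<Rightarrow> real) \<Rightarrow> 'a \<times> 'b \<Rightarrow> 'a \<times> 'b \<Rightarrow> real" where
  "oplus_p p \<alpha> \<beta> u v =
     (\<alpha> (fst u) (fst v) powr p + \<beta> (snd u) (snd v) powr p) powr (1 / p)"

definition oplus_choices ::
  "('a \<Rightarrow> 'a \<Rightarrow> real) \<Rightarrow> ('b \<Rightarrow> 'b \<Rightarrow> real) \<Rightarrow> ('a \<times> 'b \<Rightarrow> 'a \<times> 'b \<Rightarrow> real) set" where
  "oplus_choices \<alpha> \<beta> = insert (oplus_max \<alpha> \<beta>) {oplus_p p \<alpha> \<beta> | p. 1 \<le> p}"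

text \<open>Whether a function on a product is Lipschitz does not depend on the choice of \<open>\<alpha> \<oplus> \<beta>\<close>, but
  its smallest Lipschitz constant does.  The two lemmas below (for the identity of the real line)
  show that \<open>Lip(\<kappa>) = Lip(f\<^sup>-\<^sup>1)\<close> fails for the maximum and for every \<open>p > 1\<close>, so that this
  equality has to be read with \<open>\<alpha> \<oplus> \<beta> = \<alpha> + \<beta>\<close>, which is \<open>oplus_p 1\<close>.\<close>

lemma Lip_inverse_id_real: "Lip_inverse UNIV dist dist (\<lambda>x::real. x) = 1"
  unfolding Lip_inverse_def
proof (rule Least_equality)
  fix L :: real
  assume "0 \<le> L \<and> (\<forall>x\<in>UNIV. \<forall>x'\<in>UNIV. dist x x' \<le> L * dist x (x'::real))"
  then have "dist 1 (0::real) \<le> L * dist 1 (0::real)" by blast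
  then show "1 \<le> L" by simp
qed simp

lemma Lip_neq_Lip_inverse_max:
  "Lip (UNIV \<times> UNIV)
     (oplus_max (pullback (\<lambda>x. x) dist) (pullback (\<lambda>x. x) dist)) dist
     (\<lambda>(x::real, y). dist x y)
   \<noteq> Lip_inverse UNIV dist dist (\<lambda>x::real. x)"
proof -
  let ?\<rho> = "oplus_max (pullback (\<lambda>x::real. x) dist) (pullback (\<lambda>x::real. x) dist)"
  have "Lip (UNIV \<times> UNIV) ?\<rho> dist (\<lambda>(x::real, y). dist x y) = 2"
    unfolding Lip_def
  proof (rule Least_equality)
    show "lipschitz_const (UNIV \<times> UNIV) ?\<rho> dist (\<lambda>(x::real, y). dist x y) 2"
      by (auto simp: lipschitz_const_def oplus_max_def pullback_def dist_real_def)
        (smt (verit) max_def)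
  next
    fix L :: real
    assume "lipschitz_const (UNIV \<times> UNIV) ?\<rho> dist (\<lambda>(x::real, y). dist x y) L"
    then have "\<forall>u\<in>UNIV \<times> UNIV. \<forall>v\<in>UNIV \<times> UNIV.
        dist (case u of (x, y) \<Rightarrow> dist x y) (case v of (x, y) \<Rightarrow> dist x y)
        \<le> L * max (?\<rho> u v) (?\<rho> v u)"
      unfolding lipschitz_const_def by blast
    from bspec[OF bspec[OF this, of "(1, -1)"], of "(0, 0)"]
    show "2 \<le> L"
      by (simp add: oplus_max_def pullback_def dist_real_def)
  qed
  then show ?thesis
    by (simp add: Lip_inverse_id_real)
qed

lemma Lip_neq_Lip_inverse_p:
  assumes p: "1 < p"
  shows "Lip (UNIV \<times> UNIV)
     (oplus_p p (pullback (\<lambda>x. x) dist) (pullback (\<lambda>x. x) dist)) dist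
     (\<lambda>(x::real, y). dist x y)
   \<noteq> Lip_inverse UNIV dist dist (\<lambda>x::real. x)"
proof -
  let ?\<rho> = "oplus_p p (pullback (\<lambda>x::real. x) dist) (pullback (\<lambda>x::real. x) dist)"
  let ?P = "lipschitz_const (UNIV \<times> UNIV) ?\<rho> dist (\<lambda>(x::real, y). dist x y)"
  let ?M = "2 powr (1 - 1 / p) :: real"
  have sym: "?\<rho> u v = ?\<rho> v u" for u v
    by (simp add: oplus_p_def pullback_def dist_commute)
  have mean: "a + b \<le> ?M * (a powr p + b powr p) powr (1 / p)"
    if ab: "0 \<le> a" "0 \<le> b" for a b :: real
  proof -
    have "((a + b) / 2) powr p \<le> (a powr p + b powr p) / 2"
    proof (cases "a = 0 \<or> b = 0")
      case True
      have "(c / 2) powr p \<le> c powr p / 2" if "0 \<le> c" for c :: real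
      proof -
        have "2 * c powr p \<le> 2 powr p * c powr p"
          using p powr_mono[of 1 p 2] by (intro mult_right_mono) auto
        then show ?thesis
          using that by (simp add: powr_divide field_simps)
      qed
      from this[of a] this[of b] show ?thesis
        using True p ab by auto
    next
      case False
      then show ?thesis
        using convex_onD[OF powr_convex[of p], of "1/2" a b] p ab by (simp add: field_simps)
    qed
    then have "(((a + b) / 2) powr p) powr (1 / p) \<le> ((a powr p + b powr p) / 2) powr (1 / p)"
      using p by (intro powr_mono2) auto
    then have "(a + b) / 2 \<le> (a powr p + b powr p) powr (1 / p) / 2 powr (1 / p)"
      using p ab by (simp add: powr_powr powr_divide)
    then show ?thesis
      by (simp add: powr_diff field_simps)
  qed
  have "Lip (UNIV \<times> UNIV) ?\<rho> dist (\<lambda>(x::real, y). dist x y) = ?M"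
    unfolding Lip_def
  proof (rule Least_equality)
    have "dist (dist x y) (dist x' y') \<le> ?M * ?\<rho> (x, y) (x', y')" for x y x' y' :: real
    proof -
      have "dist (dist x y) (dist x' y') \<le> dist x x' + dist y y'"
        by (auto simp: dist_real_def)
      also have "\<dots> \<le> ?M * ?\<rho> (x, y) (x', y')"
        using mean[of "dist x x'" "dist y y'"] by (simp add: oplus_p_def pullback_def)
      finally show ?thesis .
    qed
    then show "?P ?M"
      by (auto simp: lipschitz_const_def sym[of _ _])
  next
    fix L :: real
    assume L: "?P L"
    then have "\<forall>u\<in>UNIV \<times> UNIV. \<forall>v\<in>UNIV \<times> UNIV.
        dist (case u of (x, y) \<Rightarrow> dist x y) (case v of (x, y) \<Rightarrow> dist x y)
        \<le> L * max (?\<rho> u v) (?\<rho> v u)"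
      unfolding lipschitz_const_def by blast
    from bspec[OF bspec[OF this, of "(1, -1)"], of "(0, 0)"]
    have "2 \<le> L * 2 powr (1 / p)"
      by (simp add: oplus_p_def pullback_def dist_real_def)
    then show "?M \<le> L"
      by (simp add: powr_diff field_simps)
  qed
  moreover have "?M > 1"
    using p by simp
  ultimately show ?thesis
    using p by (simp add: Lip_inverse_id_real)
qed

end

theory Submission
  imports Defs
begin

text \<open>
  Both properties of \<open>f\<close> say that \<open>\<kappa>\<close> is bounded by a multiple of the pullback \<open>\<tau> = f\<^sup>* \<sigma>\<close>:
  \<open>\<kappa> x x' \<le> L * \<tau> x x'\<close> for all \<open>x, x'\<close> in \<open>X\<close>.  For the lower Lipschitz property, \<open>L\<close> is the
  reciprocal of the lower constant.

  If \<open>\<kappa>\<close> is \<open>L\<close>-Lipschitz on the product, the bound follows by comparing its values at \<open>(x, x')\<close>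
  and at the diagonal point \<open>(x', x')\<close>, where \<open>\<kappa>\<close> vanishes.  These two points differ only in the
  first coordinate, so every admissible \<open>\<tau> \<oplus> \<tau>\<close> gives them the distance \<open>\<tau> x x'\<close>, and \<open>L\<close> is
  preserved (\<open>dominated_if_lipschitz_on_product\<close>).  Conversely, the triangle inequality used
  twice bounds the variation of \<open>\<kappa>\<close> between \<open>(x, x')\<close> and \<open>(y, y')\<close> by sums of the form
  \<open>\<kappa> x y + \<kappa> y' x'\<close>, hence by \<open>L\<close> times the sum of the two coordinate distances
  (\<open>lipschitz_on_product_if_dominated\<close>).  That sum is at most twice any \<open>\<tau> \<oplus> \<tau>\<close>, which settles
  the equivalence, and it equals \<open>\<tau> \<oplus> \<tau>\<close> for \<open>p = 1\<close>.  In the latter case the two sets of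
  admissible constants coincide, and with them their least elements.
\<close>

definition dominated ::
  "'a set \<Rightarrow> ('a \<Rightarrow> 'a \<Rightarrow> real) \<Rightarrow> ('a \<Rightarrow> 'a \<Rightarrow> real) \<Rightarrow> real \<Rightarrow> bool" where
  "dominated X \<kappa> \<tau> L \<longleftrightarrow> 0 \<le> L \<and> (\<forall>x\<in>X. \<forall>x'\<in>X. \<kappa> x x' \<le> L * \<tau> x x')"

lemma pseudometric_on_pullback:
  assumes "pseudometric_on Y \<sigma>" and "f \<in> X \<rightarrow> Y"
  shows "pseudometric_on X (pullback f \<sigma>)"
  unfolding pseudometric_on_def weak_metric_on_def pullback_def
proof (intro conjI ballI)
  fix x y z assume "x \<in> X" "y \<in> X" "z \<in> X"
  then have "f x \<in> Y" "f y \<in> Y" "f z \<in> Y"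
    using assms(2) by auto
  then show "\<sigma> (f x) (f z) \<le> \<sigma> (f x) (f y) + \<sigma> (f y) (f z)"
    using assms(1) by (auto simp: pseudometric_on_def weak_metric_on_def)
qed (use assms in \<open>auto simp: pseudometric_on_def weak_metric_on_def Pi_iff\<close>)

lemma lower_lipschitz_map_iff_dominated:
  assumes "pseudometric_on X (pullback f \<sigma>)"
  shows "lower_lipschitz_map X \<kappa> \<sigma> f \<longleftrightarrow> (\<exists>L. dominated X \<kappa> (pullback f \<sigma>) L)"
proof
  assume "lower_lipschitz_map X \<kappa> \<sigma> f"
  then obtain l where l: "0 < l"
    "\<And>x x'. x \<in> X \<Longrightarrow> x' \<in> X \<Longrightarrow> l * max (\<kappa> x x') (\<kappa> x' x) \<le> \<sigma> (f x) (f x')"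
    unfolding lower_lipschitz_map_def by blast
  have "\<kappa> x x' \<le> 1 / l * pullback f \<sigma> x x'" if "x \<in> X" "x' \<in> X" for x x'
  proof -
    have "l * \<kappa> x x' \<le> l * max (\<kappa> x x') (\<kappa> x' x)"
      using l(1) by simp
    also have "\<dots> \<le> pullback f \<sigma> x x'"
      using l(2) that by (simp add: pullback_def)
    finally show ?thesis
      using l(1) by (simp add: field_simps)
  qed
  then have "dominated X \<kappa> (pullback f \<sigma>) (1 / l)"
    using l(1) by (simp add: dominated_def)
  then show "\<exists>L. dominated X \<kappa> (pullback f \<sigma>) L" ..
next
  assume "\<exists>L. dominated X \<kappa> (pullback f \<sigma>) L"
  then obtain L where L: "0 \<le> L"
    "\<And>x x'. x \<in> X \<Longrightarrow> x' \<in> X \<Longrightarrow> \<kappa> x x' \<le> L * pullback f \<sigma> x x'"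
    unfolding dominated_def by blast
  \<comment> \<open>The constant \<open>L\<close> may be \<open>0\<close>, so its reciprocal is taken after increasing it by \<open>1\<close>.\<close>
  have "1 / (L + 1) * max (\<kappa> x x') (\<kappa> x' x) \<le> \<sigma> (f x) (f x')"
    if x: "x \<in> X" "x' \<in> X" for x x'
  proof -
    have "0 \<le> pullback f \<sigma> x x'" "pullback f \<sigma> x' x = pullback f \<sigma> x x'"
      using assms x by (auto simp: pseudometric_on_def weak_metric_on_def)
    then have "max (\<kappa> x x') (\<kappa> x' x) \<le> (L + 1) * pullback f \<sigma> x x'"
      using L(2)[of x x'] L(2)[of x' x] x by (auto simp: algebra_simps)
    then show ?thesis
      using L(1) by (simp add: pullback_def field_simps)
  qed
  moreover have "0 < 1 / (L + 1)"
    using L(1) by simp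
  ultimately show "lower_lipschitz_map X \<kappa> \<sigma> f"
    unfolding lower_lipschitz_map_def by blast
qed

lemma oplus_choices_same_snd:
  assumes "\<rho> \<in> oplus_choices \<alpha> \<beta>" and "0 \<le> \<alpha> a a'" and "\<beta> b b = 0"
  shows "\<rho> (a, b) (a', b) = \<alpha> a a'"
  using assms by (auto simp: oplus_choices_def oplus_max_def oplus_p_def powr_powr)

lemma sum_le_twice_oplus:
  assumes "\<rho> \<in> oplus_choices \<alpha> \<beta>" and "0 \<le> \<alpha> a a'" and "0 \<le> \<beta> b b'"
  shows "\<alpha> a a' + \<beta> b b' \<le> 2 * \<rho> (a, b) (a', b')"
proof -
  have le: "s \<le> (s powr p + t powr p) powr (1 / p)" if "1 \<le> p" "0 \<le> s" for p s t :: real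
  proof -
    have "s = (s powr p) powr (1 / p)"
      using that by (simp add: powr_powr)
    also have "\<dots> \<le> (s powr p + t powr p) powr (1 / p)"
      using that by (intro powr_mono2) auto
    finally show ?thesis .
  qed
  have "\<alpha> a a' \<le> \<rho> (a, b) (a', b') \<and> \<beta> b b' \<le> \<rho> (a, b) (a', b')"
    using assms le[of _ "\<alpha> a a'" "\<beta> b b'"] le[of _ "\<beta> b b'" "\<alpha> a a'"]
    by (auto simp: oplus_choices_def oplus_max_def oplus_p_def add.commute)
  then show ?thesis by linarith
qed

lemma oplus_p_1_eq_sum:
  assumes "0 \<le> \<alpha> a a'" and "0 \<le> \<beta> b b'"
  shows "oplus_p 1 \<alpha> \<beta> (a, b) (a', b') = \<alpha> a a' + \<beta> b b'"
  using assms by (simp add: oplus_p_def)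

text \<open>Going from \<open>x\<close> to \<open>x'\<close> by way of \<open>y\<close> and \<open>y'\<close> bounds \<open>\<kappa> x x' - \<kappa> y y'\<close>, and exchanging the
  roles of the two pairs bounds its negative.  Without symmetry of \<open>\<kappa>\<close> the two detours have
  different lengths, hence the maximum.\<close>

lemma weak_metric_variation:
  assumes \<kappa>: "weak_metric_on X \<kappa>" and X: "x \<in> X" "x' \<in> X" "y \<in> X" "y' \<in> X"
  shows "dist (\<kappa> x x') (\<kappa> y y') \<le> max (\<kappa> x y + \<kappa> y' x') (\<kappa> y x + \<kappa> x' y')"
proof -
  have tri: "\<kappa> a c \<le> \<kappa> a b + \<kappa> b c" if "a \<in> X" "b \<in> X" "c \<in> X" for a b c
    using \<kappa> that by (auto simp: weak_metric_on_def)
  have "\<kappa> x x' \<le> \<kappa> x y + (\<kappa> y y' + \<kappa> y' x')"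
    using tri[of x y x'] tri[of y y' x'] X by linarith
  moreover have "\<kappa> y y' \<le> \<kappa> y x + (\<kappa> x x' + \<kappa> x' y')"
    using tri[of y x y'] tri[of x x' y'] X by linarith
  ultimately show ?thesis
    unfolding dist_real_def by linarith
qed

text \<open>The factor \<open>C\<close> measures how far \<open>\<rho>\<close> falls below the sum of the coordinate distances.  The
  choice \<open>C = 2\<close> serves every \<open>\<tau> \<oplus> \<tau>\<close>, while \<open>C = 1\<close> for the sum itself gives the sharp constant.\<close>

lemma lipschitz_on_product_if_dominated:
  assumes \<kappa>: "weak_metric_on X \<kappa>" and \<tau>: "pseudometric_on X \<tau>" and L: "dominated X \<kappa> \<tau> L"
    and "0 \<le> C"
    and \<rho>: "\<And>x x' y y'. x \<in> X \<Longrightarrow> x' \<in> X \<Longrightarrow> y \<in> X \<Longrightarrow> y' \<in> X \<Longrightarrow>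
           \<tau> x y + \<tau> x' y' \<le> C * \<rho> (x, x') (y, y')"
  shows "lipschitz_const (X \<times> X) \<rho> dist (\<lambda>(x, x'). \<kappa> x x') (L * C)"
proof -
  have L0: "0 \<le> L" and dom: "\<And>x y. x \<in> X \<Longrightarrow> y \<in> X \<Longrightarrow> \<kappa> x y \<le> L * \<tau> x y"
    using L by (auto simp: dominated_def)
  have sym: "\<tau> x y = \<tau> y x" if "x \<in> X" "y \<in> X" for x y
    using \<tau> that by (auto simp: pseudometric_on_def)
  have "dist (\<kappa> x x') (\<kappa> y y') \<le> L * C * max (\<rho> (x, x') (y, y')) (\<rho> (y, y') (x, x'))"
    if X: "x \<in> X" "x' \<in> X" "y \<in> X" "y' \<in> X" for x x' y y'
  proof -
    have "dist (\<kappa> x x') (\<kappa> y y') \<le> max (\<kappa> x y + \<kappa> y' x') (\<kappa> y x + \<kappa> x' y')"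
      using weak_metric_variation[OF \<kappa> X] .
    also have "\<dots> \<le> L * (\<tau> x y + \<tau> x' y')"
      using dom[of x y] dom[of y' x'] dom[of y x] dom[of x' y'] sym[of x y] sym[of x' y'] X
      by (simp add: distrib_left)
    also have "\<dots> \<le> L * (C * \<rho> (x, x') (y, y'))"
      using \<rho>[OF X] L0 by (intro mult_left_mono)
    also have "\<dots> = L * C * \<rho> (x, x') (y, y')"
      by simp
    also have "\<dots> \<le> L * C * max (\<rho> (x, x') (y, y')) (\<rho> (y, y') (x, x'))"
      using L0 \<open>0 \<le> C\<close> by (intro mult_left_mono) auto
    finally show ?thesis .
  qed
  then show ?thesis
    using L0 \<open>0 \<le> C\<close> by (auto simp: lipschitz_const_def)
qed

lemma dominated_if_lipschitz_on_product:
  assumes \<kappa>: "weak_metric_on X \<kappa>" and \<tau>: "pseudometric_on X \<tau>"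
    and \<rho>: "\<rho> \<in> oplus_choices \<tau> \<tau>"
    and L: "lipschitz_const (X \<times> X) \<rho> dist (\<lambda>(x, x'). \<kappa> x x') L"
  shows "dominated X \<kappa> \<tau> L"
proof -
  have "\<kappa> x x' \<le> L * \<tau> x x'" if X: "x \<in> X" "x' \<in> X" for x x'
  proof -
    have \<tau>': "0 \<le> \<tau> x x'" "0 \<le> \<tau> x' x" "\<tau> x' x' = 0" "\<tau> x' x = \<tau> x x'"
      using \<tau> X by (auto simp: pseudometric_on_def weak_metric_on_def)
    have "\<kappa> x x' \<le> dist (\<kappa> x x') (\<kappa> x' x')"
      using \<kappa> X by (auto simp: weak_metric_on_def)
    also have "\<dots> \<le> L * max (\<rho> (x, x') (x', x')) (\<rho> (x', x') (x, x'))"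
      using L X by (force simp: lipschitz_const_def)
    also have "\<dots> = L * \<tau> x x'"
      using oplus_choices_same_snd[OF \<rho>, of x x' x'] oplus_choices_same_snd[OF \<rho>, of x' x x'] \<tau>'
      by simp
    finally show ?thesis .
  qed
  then show ?thesis
    using L by (simp add: dominated_def lipschitz_const_def)
qed

lemma lipschitz_on_product_iff_dominated:
  assumes \<kappa>: "weak_metric_on X \<kappa>" and \<tau>: "pseudometric_on X \<tau>"
    and \<rho>: "\<rho> \<in> oplus_choices \<tau> \<tau>"
  shows "lipschitz_map (X \<times> X) \<rho> dist (\<lambda>(x, x'). \<kappa> x x') \<longleftrightarrow> (\<exists>L. dominated X \<kappa> \<tau> L)"
proof -
  have "\<tau> x y + \<tau> x' y' \<le> 2 * \<rho> (x, x') (y, y')"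
    if "x \<in> X" "x' \<in> X" "y \<in> X" "y' \<in> X" for x x' y y'
    using sum_le_twice_oplus[OF \<rho>] \<tau> that
    by (auto simp: pseudometric_on_def weak_metric_on_def)
  then show ?thesis
    using lipschitz_on_product_if_dominated[OF \<kappa> \<tau>, where C = 2 and \<rho> = \<rho>]
      dominated_if_lipschitz_on_product[OF \<kappa> \<tau> \<rho>]
    unfolding lipschitz_map_def by fastforce
qed

lemma lipschitz_const_on_sum_iff_dominated:
  assumes \<kappa>: "weak_metric_on X \<kappa>" and \<tau>: "pseudometric_on X \<tau>"
  shows "lipschitz_const (X \<times> X) (oplus_p 1 \<tau> \<tau>) dist (\<lambda>(x, x'). \<kappa> x x') L \<longleftrightarrow> dominated X \<kappa> \<tau> L"
proof
  have "oplus_p 1 \<tau> \<tau> \<in> oplus_choices \<tau> \<tau>"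
    by (auto simp: oplus_choices_def)
  then show "dominated X \<kappa> \<tau> L"
    if "lipschitz_const (X \<times> X) (oplus_p 1 \<tau> \<tau>) dist (\<lambda>(x, x'). \<kappa> x x') L"
    using dominated_if_lipschitz_on_product[OF \<kappa> \<tau>] that by blast
next
  have "\<tau> x y + \<tau> x' y' \<le> 1 * oplus_p 1 \<tau> \<tau> (x, x') (y, y')"
    if "x \<in> X" "x' \<in> X" "y \<in> X" "y' \<in> X" for x x' y y'
    using \<tau> that by (auto simp: oplus_p_1_eq_sum pseudometric_on_def weak_metric_on_def)
  then show "lipschitz_const (X \<times> X) (oplus_p 1 \<tau> \<tau>) dist (\<lambda>(x, x'). \<kappa> x x') L"
    if "dominated X \<kappa> \<tau> L"
    using lipschitz_on_product_if_dominated[OF \<kappa> \<tau> that, where C = 1] by simp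
qed

theorem theorem2p7:
  fixes X :: "'a set" and Y :: "'b set"
    and \<kappa> :: "'a \<Rightarrow> 'a \<Rightarrow> real" and \<sigma> :: "'b \<Rightarrow> 'b \<Rightarrow> real" and f :: "'a \<Rightarrow> 'b"
  assumes "weak_metric_on X \<kappa>" and "pseudometric_on Y \<sigma>" and "f \<in> X \<rightarrow> Y"
  shows "(\<forall>\<rho>\<in>oplus_choices (pullback f \<sigma>) (pullback f \<sigma>).
            lower_lipschitz_map X \<kappa> \<sigma> f \<longleftrightarrow>
            lipschitz_map (X \<times> X) \<rho> dist (\<lambda>(x, x'). \<kappa> x x'))
       \<and> (lower_lipschitz_map X \<kappa> \<sigma> f \<longrightarrow>
            Lip (X \<times> X) (oplus_p 1 (pullback f \<sigma>) (pullback f \<sigma>)) dist (\<lambda>(x, x'). \<kappa> x x')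
            = Lip_inverse X \<kappa> \<sigma> f)
       \<and> (lower_lipschitz_map X \<kappa> \<sigma> f \<and> lipschitz_map X \<kappa> \<sigma> f \<longrightarrow>
            bi_lipschitz_onto_image X \<kappa> \<sigma> f)"
proof -
  note \<kappa> = assms(1)
  have \<tau>: "pseudometric_on X (pullback f \<sigma>)"
    using pseudometric_on_pullback assms(2,3) .
  have "Lip (X \<times> X) (oplus_p 1 (pullback f \<sigma>) (pullback f \<sigma>)) dist (\<lambda>(x, x'). \<kappa> x x')
      = (LEAST L. dominated X \<kappa> (pullback f \<sigma>) L)"
    unfolding Lip_def lipschitz_const_on_sum_iff_dominated[OF \<kappa> \<tau>] ..
  also have "\<dots> = Lip_inverse X \<kappa> \<sigma> f"
    by (simp add: Lip_inverse_def dominated_def pullback_def)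
  finally show ?thesis
    using lower_lipschitz_map_iff_dominated[OF \<tau>] lipschitz_on_product_iff_dominated[OF \<kappa> \<tau>]
    by (auto simp: bi_lipschitz_onto_image_def)
qed

end
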